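(* Let $L$ be the Laplacian matrix of a tree $T=(V,E)$ with real $s\times s$ matrix weights $W(e)$ on its edges. Let $L_v$ be the principal submatrix of $L$ obtained by deleting the row block and column block corresponding to a vertex $v\in V$. Then $$\det L_v=\prod_{e\in E}\det W(e).$$
   Context: Laplacian: for a tree on $n$ vertices with $s\times s$ matrix edge weights, $L=[l_{uv}]_{u,v\in V}$ is the $ns\times ns$ block matrix whose $s\times s$ blocks are: for $u\ne v$, $l_{uv}=-W(e)$ if $u,v$ are joined by the edge $e$, and $l_{uv}=\mathbf 0$ if $u,v$ are not adjacent; $l_{vv}$ is the sum of the weights of the edges incident with $v$. *)

theory Defs
  imports "Jordan_Normal_Form.Determinant" "Jordan_Normal_Form.DL_Submatrix"
begin

text \<open>
  Finite simple undirected graphs with vertex set \<open>V\<close> and edge set \<open>E\<close>; an edge is the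
  two-element set of its endpoints. (The notion \<open>tree\<close> of the AFP entry \<open>Graph_Theory\<close> only
  excludes directed cycles, so it is not the undirected notion.)
\<close>

definition simple_graph :: "'a set \<Rightarrow> 'a set set \<Rightarrow> bool" where
  "simple_graph V E \<longleftrightarrow>
     finite V \<and> (\<forall>e\<in>E. \<exists>u v. e = {u, v} \<and> u \<in> V \<and> v \<in> V \<and> u \<noteq> v)"

definition walk :: "'a set \<Rightarrow> 'a set set \<Rightarrow> 'a list \<Rightarrow> bool" where
  "walk V E p \<longleftrightarrow>
     p \<noteq> [] \<and> set p \<subseteq> V \<and> (\<forall>i. Suc i < length p \<longrightarrow> {p ! i, p ! Suc i} \<in> E)"

definition connected_graph :: "'a set \<Rightarrow> 'a set set \<Rightarrow> bool" where
  "connected_graph V E \<longleftrightarrow>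
     V \<noteq> {} \<and> (\<forall>u\<in>V. \<forall>v\<in>V. \<exists>p. walk V E p \<and> hd p = u \<and> last p = v)"

text \<open>A cycle is listed without repeating its first vertex at the end.\<close>

definition graph_cycle :: "'a set \<Rightarrow> 'a set set \<Rightarrow> 'a list \<Rightarrow> bool" where
  "graph_cycle V E c \<longleftrightarrow>
     walk V E c \<and> 3 \<le> length c \<and> distinct c \<and> {last c, hd c} \<in> E"

definition is_tree :: "'a set \<Rightarrow> 'a set set \<Rightarrow> bool" where
  "is_tree V E \<longleftrightarrow>
     simple_graph V E \<and> connected_graph V E \<and> (\<nexists>c. graph_cycle V E c)"

text \<open>
  The sum of the incident weights is written entrywise, since matrices with explicit dimensions
  do not form a type-class monoid.
\<close>

definition laplacian_block ::
  "nat \<Rightarrow> 'a set set \<Rightarrow> ('a set \<Rightarrow> real mat) \<Rightarrow> 'a \<Rightarrow> 'a \<Rightarrow> real mat" where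
  "laplacian_block s E W u v =
     (if u = v then mat s s (\<lambda>(i, j). \<Sum>e \<in> {e \<in> E. v \<in> e}. W e $$ (i, j))
      else if {u, v} \<in> E then - W {u, v}
      else 0\<^sub>m s s)"

text \<open>
  The list \<open>vs\<close> fixes the order of the vertices: rows and columns \<open>k * s, \<dots>, k * s + s - 1\<close> belong
  to the vertex \<open>vs ! k\<close>.
\<close>

definition laplacian ::
  "nat \<Rightarrow> 'a list \<Rightarrow> 'a set set \<Rightarrow> ('a set \<Rightarrow> real mat) \<Rightarrow> real mat" where
  "laplacian s vs E W =
     mat (length vs * s) (length vs * s)
       (\<lambda>(i, j). laplacian_block s E W (vs ! (i div s)) (vs ! (j div s)) $$ (i mod s, j mod s))"

definition delete_vertex_block :: "nat \<Rightarrow> 'a list \<Rightarrow> 'a \<Rightarrow> real mat \<Rightarrow> real mat" where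
  "delete_vertex_block s vs v L =
     (let I = {i. i < length vs * s \<and> vs ! (i div s) \<noteq> v} in submatrix L I I)"

end

theory Submission
  imports Defs
begin

text \<open>
  Root the tree at \<open>v\<close>. Every other vertex \<open>u\<close> has a parent, strictly closer to \<open>v\<close>, and
  \<open>u \<mapsto> {u, par u}\<close> is a bijection from \<open>V - {v}\<close> onto \<open>E\<close> (\<open>tree_parent_edge_bij\<close>): it is
  injective because depth decreases towards the root, and an edge that it missed would close a
  cycle with a path of parent edges joining its ends. So the edges can be indexed by the vertices
  other than \<open>v\<close>, and the oriented incidence matrix with the row of \<open>v\<close> deleted becomes square.

  Let \<open>Q\<close> be this matrix with every entry multiplied by the \<open>s \<times> s\<close> identity, and let \<open>D\<close> be the
  block diagonal matrix of the edge weights. Then \<open>L\<^sub>v = Q D Q\<^sup>T\<close>, as for the scalar Laplacian: the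
  blocks of \<open>Q\<close> are integer multiples of the identity, so they commute with the weights although
  the weights need not commute with each other.

  Finally \<open>det Q = 1\<close>, since \<open>Q\<close> has ones on the diagonal and a nonzero entry off the diagonal
  leads from a parent to its child, hence strictly increases the depth (\<open>det_rank_triangular\<close>);
  and \<open>det D\<close> is the product of the determinants of its blocks (\<open>det_block_diagonal\<close>), that is,
  the product of \<open>det (W e)\<close> over all edges.
\<close>

section \<open>Rooted trees\<close>

lemma walk_iff_successively:
  "walk V E p \<longleftrightarrow> p \<noteq> [] \<and> set p \<subseteq> V \<and> successively (\<lambda>x y. {x, y} \<in> E) p"
  unfolding walk_def successively_conv_nth by (auto simp: Suc_lessD)

text \<open>
  Prepending a vertex to a repetition-free walk either keeps it repetition-free, or the new vertex
  already occurs, and the part of the walk before that occurrence can be cut off.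
\<close>
lemma distinct_walk_of_rtrancl:
  assumes "(x, y) \<in> {(a, b). {a, b} \<in> F}\<^sup>*" "y \<in> V" "\<And>e. e \<in> F \<Longrightarrow> e \<subseteq> V"
  shows "\<exists>p. walk V F p \<and> hd p = x \<and> last p = y \<and> distinct p"
  using assms(1)
proof (induction rule: converse_rtrancl_induct)
  case base
  show ?case using assms(2) by (intro exI[of _ "[y]"]) (simp add: walk_iff_successively)
next
  case (step x z)
  then obtain p where p: "walk V F p" "hd p = z" "last p = y" "distinct p" by blast
  show ?case
  proof (cases "x \<in> set p")
    case True
    then obtain a b where "p = a @ x # b" by (meson split_list)
    with p show ?thesis
      by (intro exI[of _ "x # b"]) (auto simp: walk_iff_successively successively_append_iff)
  next
    case False
    with p step assms(3) show ?thesis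
      by (intro exI[of _ "x # p"]) (force simp: walk_iff_successively successively_Cons)
  qed
qed

text \<open>
  The parent of \<open>u\<close> is the second vertex of a shortest walk from \<open>u\<close> to the root. Acyclicity is
  what makes the parent edges exhaust \<open>E\<close>.
\<close>
lemma tree_parent_edge_bij:
  assumes tree: "is_tree V E" and v: "v \<in> V"
  obtains par and depth :: "'a \<Rightarrow> nat"
  where "\<And>u. u \<in> V - {v} \<Longrightarrow> depth (par u) < depth u"
    and "bij_betw (\<lambda>u. {u, par u}) (V - {v}) E"
proof -
  have edge: "\<exists>u w. e = {u, w} \<and> u \<in> V \<and> w \<in> V \<and> u \<noteq> w" if "e \<in> E" for e
    using tree that unfolding is_tree_def simple_graph_def by blast
  have conn: "\<exists>p. walk V E p \<and> hd p = u \<and> last p = v" if "u \<in> V" for u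
    using tree v that unfolding is_tree_def connected_graph_def by blast
  have acyc: "\<not> graph_cycle V E c" for c using tree unfolding is_tree_def by blast
  \<comment> \<open>Counted in vertices, so the root has depth 1.\<close>
  define depth where
    "depth u = (LEAST n. \<exists>p. walk V E p \<and> hd p = u \<and> last p = v \<and> length p = n)" for u
  have "\<exists>w. {u, w} \<in> E \<and> depth w < depth u" if u: "u \<in> V - {v}" for u
  proof -
    have "\<exists>n p. walk V E p \<and> hd p = u \<and> last p = v \<and> length p = n" using conn u by blast
    from LeastI_ex[OF this] obtain p
      where p: "walk V E p" "hd p = u" "last p = v" "length p = depth u"
      unfolding depth_def by blast
    then obtain q where q: "p = u # q" by (cases p) (auto simp: walk_def)
    with p u obtain w r where r: "q = w # r" by (cases q) auto
    have "walk V E (w # r)" "last (w # r) = v" "{u, w} \<in> E"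
      using p q r by (auto simp: walk_iff_successively)
    then have "depth w \<le> length (w # r)"
      unfolding depth_def by (intro Least_le) (metis list.sel(1))
    with p q r \<open>{u, w} \<in> E\<close> show ?thesis by auto
  qed
  then obtain par where par: "\<And>u. u \<in> V - {v} \<Longrightarrow> {u, par u} \<in> E"
    and depth: "\<And>u. u \<in> V - {v} \<Longrightarrow> depth (par u) < depth u" by metis
  define F where "F = (\<lambda>u. {u, par u}) ` (V - {v})"
  have FE: "F \<subseteq> E" unfolding F_def using par by auto
  let ?R = "{(a, b). {a, b} \<in> F}"
  have sym: "sym (?R\<^sup>*)" by (rule sym_rtrancl) (auto simp: sym_def insert_commute)
  have to_root: "(u, v) \<in> ?R\<^sup>*" if "u \<in> V" for u
    using that
  proof (induction "depth u" arbitrary: u rule: less_induct)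
    case less
    show ?case
    proof (cases "u = v")
      case False
      then have u: "u \<in> V - {v}" using less by simp
      then have "par u \<in> V" using edge[OF par[OF u]] by (auto simp: doubleton_eq_iff)
      then have "(par u, v) \<in> ?R\<^sup>*" using less.hyps[OF depth[OF u]] by blast
      moreover have "(u, par u) \<in> ?R" using u by (auto simp: F_def)
      ultimately show ?thesis by (rule converse_rtrancl_into_rtrancl[rotated])
    qed simp
  qed
  \<comment> \<open>If \<open>{x, y}\<close> were not a parent edge, the path from \<open>x\<close> to \<open>y\<close> along parent edges would have
    an inner vertex, and \<open>{x, y}\<close> would close it to a cycle.\<close>
  have "E \<subseteq> F"
  proof
    fix e assume e: "e \<in> E"
    then obtain x y where xy: "e = {x, y}" "x \<in> V" "y \<in> V" "x \<noteq> y" using edge by blast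
    show "e \<in> F"
    proof (rule ccontr)
      assume nF: "e \<notin> F"
      have "(x, y) \<in> ?R\<^sup>*"
        using to_root xy(2,3) sym by (meson rtrancl_trans symD)
      moreover have "f \<subseteq> V" if "f \<in> F" for f using edge FE that by blast
      ultimately obtain p where p: "walk V F p" "hd p = x" "last p = y" "distinct p"
        using distinct_walk_of_rtrancl[of x y F V] xy(3) by blast
      have "3 \<le> length p"
      proof (rule ccontr)
        assume "\<not> 3 \<le> length p"
        with p(1) consider a where "p = [a]" | a b where "p = [a, b]"
          by (cases p; cases "tl p"; cases "tl (tl p)") (auto simp: walk_def)
        then show False using p xy nF by cases (auto simp: walk_iff_successively)
      qed
      moreover have "walk V E p" using p(1) FE unfolding walk_def by blast
      moreover have "{last p, hd p} \<in> E" using p e xy(1) by (simp add: insert_commute)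
      ultimately show False using acyc[of p] p(4) by (simp add: graph_cycle_def)
    qed
  qed
  with FE have "F = E" by blast
  moreover have "inj_on (\<lambda>u. {u, par u}) (V - {v})"
  proof (rule inj_onI, rule ccontr)
    fix x y assume "x \<in> V - {v}" "y \<in> V - {v}" "{x, par x} = {y, par y}" "x \<noteq> y"
    then show False using depth[of x] depth[of y] by (auto simp: doubleton_eq_iff)
  qed
  ultimately show thesis using that depth unfolding F_def bij_betw_def by blast
qed

section \<open>Matrices indexed by a list of blocks\<close>

text \<open>
  Entries are addressed by a block label and an offset inside the block. This lets products and
  transposes be computed by labels, independently of the order in which the list gives them.
\<close>
definition block_mat :: "nat \<Rightarrow> 'a list \<Rightarrow> ('a \<Rightarrow> 'a \<Rightarrow> nat \<Rightarrow> nat \<Rightarrow> 'b) \<Rightarrow> 'b mat" where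
  "block_mat s xs F = mat (length xs * s) (length xs * s)
     (\<lambda>(i, j). F (xs ! (i div s)) (xs ! (j div s)) (i mod s) (j mod s))"

lemma block_mat_carrier [simp]:
  "block_mat s xs F \<in> carrier_mat (length xs * s) (length xs * s)"
  by (simp add: block_mat_def)

lemma block_index_less:
  fixes i n s :: nat
  assumes "i < n * s"
  shows "i div s < n" "i mod s < s"
  using assms by (auto simp: less_mult_imp_div_less)
    (metis mod_less_divisor mult_0_right not_gr_zero not_less_zero)

lemma sum_blocks:
  fixes f :: "nat \<Rightarrow> 'b::comm_monoid_add"
  shows "(\<Sum>i<n * s. f i) = (\<Sum>k<n. \<Sum>c<s. f (k * s + c))"
proof -
  have "sum f {k * s..<k * s + s} = (\<Sum>c<s. f (k * s + c))" for k
    using sum.shift_bounds_nat_ivl[of f 0 "k * s" s]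
    by (simp add: atLeast0LessThan add.commute)
  then show ?thesis by (simp flip: sum.nat_group)
qed

lemma block_mat_cong:
  assumes "\<And>u w a b. u \<in> set xs \<Longrightarrow> w \<in> set xs \<Longrightarrow> a < s \<Longrightarrow> b < s \<Longrightarrow> F u w a b = G u w a b"
  shows "block_mat s xs F = block_mat s xs G"
  unfolding block_mat_def by (rule eq_matI) (auto intro!: assms simp: block_index_less)

lemma block_mat_transpose:
  "transpose_mat (block_mat s xs F) = block_mat s xs (\<lambda>u w a b. F w u b a)"
  unfolding block_mat_def by (rule eq_matI) auto

lemma block_mat_mult:
  fixes F G :: "'a \<Rightarrow> 'a \<Rightarrow> nat \<Rightarrow> nat \<Rightarrow> 'b::semiring_0"
  assumes "distinct xs"
  shows "block_mat s xs F * block_mat s xs G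
    = block_mat s xs (\<lambda>u w a b. \<Sum>x\<in>set xs. \<Sum>c<s. F u x a c * G x w c b)"
    (is "?A * ?B = ?C")
proof (rule eq_matI)
  fix i j assume "i < dim_row ?C" "j < dim_col ?C"
  then have ij: "i < length xs * s" "j < length xs * s" by (auto simp: block_mat_def)
  then have "(?A * ?B) $$ (i, j) = (\<Sum>k<length xs * s. ?A $$ (i, k) * ?B $$ (k, j))"
    by (auto simp: block_mat_def scalar_prod_def atLeast0LessThan)
  also have "\<dots> = (\<Sum>k<length xs. \<Sum>c<s. ?A $$ (i, k * s + c) * ?B $$ (k * s + c, j))"
    by (rule sum_blocks)
  also have "\<dots> = (\<Sum>k<length xs. \<Sum>c<s.
      F (xs ! (i div s)) (xs ! k) (i mod s) c * G (xs ! k) (xs ! (j div s)) c (j mod s))"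
  proof (intro sum.cong refl)
    fix k c assume "k \<in> {..<length xs}" and c: "c \<in> {..<s}"
    then have "Suc k * s \<le> length xs * s" by (intro mult_le_mono1) auto
    with c have "k * s + c < length xs * s" by auto
    with ij c show "?A $$ (i, k * s + c) * ?B $$ (k * s + c, j) =
      F (xs ! (i div s)) (xs ! k) (i mod s) c * G (xs ! k) (xs ! (j div s)) c (j mod s)"
      by (auto simp: block_mat_def)
  qed
  also have "\<dots> = (\<Sum>x\<in>set xs. \<Sum>c<s.
      F (xs ! (i div s)) x (i mod s) c * G x (xs ! (j div s)) c (j mod s))"
    by (rule sum.reindex_bij_betw[OF bij_betw_nth]) (use assms in auto)
  also have "\<dots> = ?C $$ (i, j)" using ij by (auto simp: block_mat_def)
  finally show "(?A * ?B) $$ (i, j) = ?C $$ (i, j)" .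
qed (auto simp: block_mat_def)

text \<open>
  If \<open>v\<close> stands at position \<open>k\<close> of \<open>vs\<close>, counted from 0, the deleted indices are the interval from \<open>k * s\<close> to
  \<open>k * s + s - 1\<close>. The increasing enumeration \<open>pick\<close> of the others fixes the indices below
  \<open>k * s\<close> and shifts the later ones by \<open>s\<close>, which is how \<open>filter\<close> moves the labels.
\<close>
lemma delete_vertex_block_mat:
  assumes "distinct vs" "v \<in> set vs"
  shows "delete_vertex_block s vs v (block_mat s vs F) = block_mat s (filter (\<lambda>u. u \<noteq> v) vs) F"
proof -
  obtain xs ys where vs: "vs = xs @ v # ys" using assms(2) by (meson split_list)
  with assms(1) have nv: "v \<notin> set xs" "v \<notin> set ys" by auto
  define k where "k = length xs"
  define n where "n = length xs + length ys"
  let ?us = "xs @ ys"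
  have us: "filter (\<lambda>u. u \<noteq> v) vs = ?us" 
  proof -
    have "filter (\<lambda>u. u \<noteq> v) xs = xs" "filter (\<lambda>u. u \<noteq> v) ys = ys"
      using nv by (auto simp: filter_id_conv)
    then show ?thesis by (simp add: vs)
  qed
  define I where "I = {i. i < length vs * s \<and> vs ! (i div s) \<noteq> v}"
  have kn: "k * s \<le> n * s" by (simp add: k_def n_def)
  have vs_eq_v: "vs ! m = v \<longleftrightarrow> m = k" if "m < Suc n" for m
    using assms(1) nth_eq_iff_index_eq[OF assms(1), of m k] that by (auto simp: vs k_def n_def)
  have len: "length vs * s = n * s + s" by (simp add: vs n_def algebra_simps)
  have I: "i \<in> I \<longleftrightarrow> i < k * s \<or> k * s + s \<le> i \<and> i < n * s + s" for i
  proof (cases "i < n * s + s")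
    case True
    then have i: "i < Suc n * s" by simp
    have s: "s > 0" using True by (cases s) auto
    have "i div s = k \<longleftrightarrow> k * s \<le> i \<and> i < Suc k * s" 
      using s less_eq_div_iff_mult_less_eq[of s k i] div_less_iff_less_mult[of s i "Suc k"] by auto
    then show ?thesis
      using block_index_less(1)[OF i] vs_eq_v[of "i div s"] True kn by (auto simp: I_def len)
  next
    case False
    then have "\<not> i < k * s" using kn by linarith
    with False show ?thesis by (auto simp: I_def len)
  qed
  define g where "g i = (if i < k * s then i else i + s)" for i
  have gI: "g i \<in> I" if "i < n * s" for i using that by (auto simp: g_def I)
  have pick: "pick I i = g i" if i: "i < n * s" for i
  proof -
    \<comment> \<open>An element of \<open>I\<close> is the value of \<open>pick\<close> at the number of smaller elements of \<open>I\<close>.\<close>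
    have "card {a \<in> I. a < g i} = i"
    proof (cases "i < k * s")
      case True
      then have "{a \<in> I. a < g i} = {..<i}" by (auto simp: g_def I)
      then show ?thesis by simp
    next
      case False
      then have "{a \<in> I. a < g i} = {..<k * s} \<union> {k * s + s..<i + s}"
        using i by (auto simp: g_def I)
      moreover have "{..<k * s} \<inter> {k * s + s..<i + s} = {}" by auto
      ultimately show ?thesis using False by (simp add: card_Un_disjoint)
    qed
    with pick_card_in_set[OF gI[OF i]] show ?thesis by simp
  qed
  have "i < n * s + s" if "i < k * s" for i using that kn by linarith
  then have "{i. i < n * s + s \<and> i \<in> I} = {..<k * s} \<union> {k * s + s..<n * s + s}"
    by (auto simp: I)
  moreover have "{..<k * s} \<inter> {k * s + s..<n * s + s} = {}" by auto
  ultimately have card: "card {i. i < n * s + s \<and> i \<in> I} = n * s"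
    using kn by (simp add: card_Un_disjoint)
  have g: "g i < n * s + s" "vs ! (g i div s) = ?us ! (i div s)" "g i mod s = i mod s"
    if i: "i < n * s" for i
  proof -
    show "g i < n * s + s" using i by (simp add: g_def)
    show "g i mod s = i mod s" by (simp add: g_def)
    have s: "s > 0" using i by (cases s) auto
    show "vs ! (g i div s) = ?us ! (i div s)"
    proof (cases "i < k * s")
      case True
      then show ?thesis
        using block_index_less(1)[OF True] by (simp add: g_def vs k_def nth_append)
    next
      case False
      then have "k \<le> i div s" using s by (simp add: less_eq_div_iff_mult_less_eq)
      then show ?thesis using False s
        by (simp add: g_def vs k_def nth_append Suc_diff_le)
    qed
  qed
  show ?thesis
  proof (rule eq_matI)
    fix i j
    assume "i < dim_row (block_mat s (filter (\<lambda>u. u \<noteq> v) vs) F)"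
      "j < dim_col (block_mat s (filter (\<lambda>u. u \<noteq> v) vs) F)"
    then have ij: "i < n * s" "j < n * s" unfolding us by (auto simp: block_mat_def n_def)
    then have "submatrix (block_mat s vs F) I I $$ (i, j) = block_mat s vs F $$ (g i, g j)"
      by (subst submatrix_index) (auto simp: block_mat_def len card pick)
    also have "\<dots> = block_mat s ?us F $$ (i, j)"
      using ij g by (simp add: block_mat_def len) (simp add: n_def)
    finally show "delete_vertex_block s vs v (block_mat s vs F) $$ (i, j)
        = block_mat s (filter (\<lambda>u. u \<noteq> v) vs) F $$ (i, j)"
      unfolding us by (simp add: delete_vertex_block_def Let_def I_def)
  qed (unfold us delete_vertex_block_def Let_def I_def[symmetric],
      auto simp: dim_submatrix block_mat_def len card simp flip: n_def)
qed

section \<open>Two determinants\<close>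

text \<open>
  This generalises triangular matrices: the rows may come in any order, as long as some rank
  increases along every nonzero entry off the diagonal. In the Leibniz formula, a permutation
  contributing a nonzero term never lowers the rank and raises it at each point that it moves;
  but the total rank is invariant under permutation, so only the identity contributes.
\<close>
lemma det_rank_triangular:
  fixes A :: "'b::comm_ring_1 mat" and r :: "nat \<Rightarrow> nat"
  assumes A: "A \<in> carrier_mat n n"
    and r: "\<And>i j. i < n \<Longrightarrow> j < n \<Longrightarrow> i \<noteq> j \<Longrightarrow> A $$ (i, j) \<noteq> 0 \<Longrightarrow> r i < r j"
  shows "det A = (\<Prod>i<n. A $$ (i, i))"
proof -
  let ?P = "{p. p permutes {0..<n}}"
  let ?t = "\<lambda>p. signof p * (\<Prod>i = 0..<n. A $$ (i, p i))"
  have zero: "?t p = 0" if p: "p \<in> ?P - {id}" for p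
  proof (rule ccontr)
    assume "?t p \<noteq> 0"
    then have nz: "A $$ (i, p i) \<noteq> 0" if "i \<in> {0..<n}" for i
      using that by (metis finite_atLeastLessThan mult_zero_right prod_zero)
    from p have perm: "p permutes {0..<n}" and "p \<noteq> id" by auto
    have strict: "r i < r (p i)" if "i \<in> {0..<n}" "p i \<noteq> i" for i
      using that nz[OF that(1)] permutes_in_image[OF perm, of i] by (intro r) auto
    obtain i where "p i \<noteq> i" using \<open>p \<noteq> id\<close> by fastforce
    moreover from this have "i \<in> {0..<n}" using permutes_not_in[OF perm] by blast
    ultimately have "\<exists>i\<in>{0..<n}. r i < r (p i)" using strict by blast
    moreover have "\<forall>i\<in>{0..<n}. r i \<le> r (p i)" using strict by (metis le_less)
    ultimately have "(\<Sum>i\<in>{0..<n}. r i) < (\<Sum>i\<in>{0..<n}. r (p i))"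
      by (intro sum_strict_mono_ex1) simp_all
    with sum.permute[OF perm, of r] show False by (simp add: comp_def)
  qed
  have "det A = sum ?t ?P" by (rule det_def'[OF A])
  also have "\<dots> = sum ?t {id}"
    using zero by (intro sum.mono_neutral_right) (auto simp: finite_permutations permutes_id)
  also have "\<dots> = (\<Prod>i<n. A $$ (i, i))" by (simp add: atLeast0LessThan)
  finally show ?thesis .
qed

lemma det_block_diagonal:
  fixes M :: "'a \<Rightarrow> 'b::idom mat"
  assumes "distinct xs" "\<And>x. x \<in> set xs \<Longrightarrow> M x \<in> carrier_mat s s"
  shows "det (block_mat s xs (\<lambda>u w a b. if u = w then M u $$ (a, b) else 0))
    = (\<Prod>x\<in>set xs. det (M x))"
  using assms
proof (induction xs)
  case Nil
  then show ?case by (simp add: block_mat_def)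
next
  case (Cons x xs)
  let ?F = "\<lambda>u w a b. if u = w then M u $$ (a, b) else 0"
  let ?m = "length xs * s"
  have Mx: "M x \<in> carrier_mat s s" using Cons.prems by simp
  have div: "i div s = Suc ((i - s) div s)" "(i - s) div s < length xs" "(i - s) mod s = i mod s"
    if "\<not> i < s" "i < s + ?m" for i
  proof -
    have "s > 0" using that by (cases s) auto
    then show "i div s = Suc ((i - s) div s)" "(i - s) mod s = i mod s"
      using that by (simp_all add: le_div_geq le_mod_geq)
    show "(i - s) div s < length xs" by (rule block_index_less) (use that in auto)
  qed
  have mem: "xs ! k \<noteq> x" "x \<noteq> xs ! k" if "k < length xs" for k
    using Cons.prems(1) that nth_mem by auto
  have "block_mat s (x # xs) ?F
      = four_block_mat (M x) (0\<^sub>m s ?m) (0\<^sub>m ?m s) (block_mat s xs ?F)" (is "?L = ?R")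
  proof (rule eq_matI)
    fix i j assume "i < dim_row ?R" "j < dim_col ?R"
    then have ij: "i < s + ?m" "j < s + ?m" using Mx by (auto simp: block_mat_def)
    then show "?L $$ (i, j) = ?R $$ (i, j)"
      using Mx Cons.prems(1) div[of i] div[of j] mem
      by (cases "i < s"; cases "j < s") (auto simp: block_mat_def)
  qed (use Mx in \<open>auto simp: block_mat_def\<close>)
  then have "det ?L = det (M x) * det (block_mat s xs ?F)"
    using det_four_block_mat_upper_right_zero[OF Mx refl, of "0\<^sub>m ?m s"] by auto
  with Cons show ?case by simp
qed

section \<open>The factorisation of the Laplacian\<close>

lemma laplacian_eq_block_mat:
  "laplacian s vs E W = block_mat s vs (\<lambda>u w a b. laplacian_block s E W u w $$ (a, b))"
  by (simp add: laplacian_def block_mat_def)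

text \<open>
  The oriented incidence matrix of the rooted tree: the column \<open>x\<close> stands for the edge from \<open>x\<close> to
  its parent, with entry \<open>1\<close> at \<open>x\<close> and \<open>-1\<close> at \<open>par x\<close>.
\<close>
definition incidence :: "('a \<Rightarrow> 'a) \<Rightarrow> 'a \<Rightarrow> 'a \<Rightarrow> real" where
  "incidence par u x = (if u = x then 1 else if u = par x then - 1 else 0)"

lemma det_incidence:
  assumes us: "distinct us"
    and depth: "\<And>x. x \<in> set us \<Longrightarrow> depth (par x) < (depth x :: nat)"
  shows "det (block_mat s us (\<lambda>u x a b. if a = b then incidence par u x else 0)) = 1"
    (is "det ?Q = 1")
proof -
  let ?N = "length us * s"
  let ?v = "\<lambda>i. us ! (i div s)"
  have "det ?Q = (\<Prod>i<?N. ?Q $$ (i, i))"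
  proof (rule det_rank_triangular[where r = "\<lambda>i. depth (?v i)"])
    fix i j assume ij: "i < ?N" "j < ?N" "i \<noteq> j" "?Q $$ (i, j) \<noteq> 0"
    then have m: "i mod s = j mod s" and nz: "incidence par (?v i) (?v j) \<noteq> 0"
      by (auto simp: block_mat_def split: if_splits)
    have l: "i div s < length us" "j div s < length us" using ij block_index_less by auto
    have "i div s \<noteq> j div s" using m ij(3) by (metis div_mult_mod_eq)
    then have "?v i \<noteq> ?v j" using us l by (simp add: nth_eq_iff_index_eq)
    with nz have "?v i = par (?v j)" by (auto simp: incidence_def split: if_splits)
    then show "depth (?v i) < depth (?v j)" using depth l by simp
  qed simp
  also have "\<dots> = 1" by (rule prod.neutral) (auto simp: block_mat_def incidence_def)
  finally show ?thesis .
qed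

text \<open>
  What the single edge \<open>{x, par x}\<close> contributes to the \<open>(u, w)\<close> block of the Laplacian: its weight
  at each of its ends, minus its weight between them.
\<close>
lemma incidence_mult:
  assumes "par x \<noteq> x"
  shows "incidence par u x * incidence par w x =
    (if u = w then of_bool (u \<in> {x, par x}) else - of_bool ({u, w} = {x, par x}))"
  using assms by (auto simp: incidence_def doubleton_eq_iff)

theorem theorem2p2:
  fixes V :: "'a set" and E :: "'a set set" and vs :: "'a list"
    and s :: nat and W :: "'a set \<Rightarrow> real mat" and v :: 'a
  assumes "is_tree V E"
    and "distinct vs" and "set vs = V"
    and "\<And>e. e \<in> E \<Longrightarrow> W e \<in> carrier_mat s s"
    and "v \<in> V"
  shows "det (delete_vertex_block s vs v (laplacian s vs E W)) = (\<Prod>e\<in>E. det (W e))"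
proof -
  obtain par and depth :: "'a \<Rightarrow> nat"
    where depth: "\<And>u. u \<in> V - {v} \<Longrightarrow> depth (par u) < depth u"
      and bij: "bij_betw (\<lambda>u. {u, par u}) (V - {v}) E"
    using tree_parent_edge_bij[OF assms(1,5)] by blast
  define us where "us = filter (\<lambda>u. u \<noteq> v) vs"
  have us: "distinct us" "set us = V - {v}" using assms(2,3) by (auto simp: us_def)
  have finE: "finite E" using bij us(2) by (metis List.finite_set bij_betw_finite)
  have W: "W {x, par x} \<in> carrier_mat s s" if "x \<in> set us" for x
    using that us(2) bij assms(4) by (auto simp: bij_betw_def)
  define Q where "Q = block_mat s us (\<lambda>u x a b. if a = b then incidence par u x else 0)"
  define D where "D = block_mat s us (\<lambda>u w a b. if u = w then W {u, par u} $$ (a, b) else 0)"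
  have "Q * D * transpose_mat Q
    = block_mat s us (\<lambda>u w a b. \<Sum>x\<in>set us.
        incidence par u x * incidence par w x * W {x, par x} $$ (a, b))"
    unfolding Q_def D_def block_mat_transpose block_mat_mult[OF us(1)]
  proof (rule block_mat_cong)
    fix u w a b assume "a < s" "b < s"
    moreover have QD: "(\<Sum>y\<in>set us. \<Sum>d<s. (if a = d then incidence par u y else 0)
        * (if y = x then W {y, par y} $$ (d, c) else 0)) = incidence par u x * W {x, par x} $$ (a, c)"
      if x: "x \<in> set us" and a: "a < s" for x a c
    proof -
      have "(\<Sum>d<s. (if a = d then incidence par u y else 0)
        * (if y = x then W {y, par y} $$ (d, c) else 0))
        = (if y = x then incidence par u y * W {y, par y} $$ (a, c) else 0)" for y
        using a by (simp add: if_distrib[of "\<lambda>t. t * _"] cong: if_cong)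
      then show ?thesis using x by simp
    qed
    ultimately show "(\<Sum>x\<in>set us. \<Sum>c<s. (\<Sum>y\<in>set us. \<Sum>d<s.
          (if a = d then incidence par u y else 0) * (if y = x then W {y, par y} $$ (d, c) else 0)) *
          (if b = c then incidence par w x else 0))
      = (\<Sum>x\<in>set us. incidence par u x * incidence par w x * W {x, par x} $$ (a, b))"
      by (simp add: QD if_distrib[of "\<lambda>t. _ * t"] cong: if_cong) (simp add: mult_ac)
  qed
  also have "\<dots> = block_mat s us (\<lambda>u w a b. laplacian_block s E W u w $$ (a, b))"
  proof (rule block_mat_cong)
    fix u w a b assume u: "u \<in> set us" and w: "w \<in> set us" and ab: "a < s" "b < s"
    have "(\<Sum>x\<in>set us. incidence par u x * incidence par w x * W {x, par x} $$ (a, b))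
      = (\<Sum>x\<in>V - {v}. (\<lambda>e. (if u = w then of_bool (u \<in> e) else - of_bool ({u, w} = e))
          * W e $$ (a, b)) {x, par x})"
    proof (rule sum.cong[OF us(2)])
      fix x assume "x \<in> V - {v}"
      from depth[OF this] have "par x \<noteq> x" by auto
      show "incidence par u x * incidence par w x * W {x, par x} $$ (a, b) =
          (\<lambda>e. (if u = w then of_bool (u \<in> e) else - of_bool ({u, w} = e)) * W e $$ (a, b)) {x, par x}"
        by (subst incidence_mult) (rule \<open>par x \<noteq> x\<close>, rule refl)
    qed
    \<comment> \<open>The summand depends only on the edge, so the sum can run over \<open>E\<close>.\<close>
    also have "\<dots> = (\<Sum>e\<in>E. (if u = w then of_bool (u \<in> e) else - of_bool ({u, w} = e)) * W e $$ (a, b))"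
      by (rule sum.reindex_bij_betw[OF bij])
    also have "\<dots> = laplacian_block s E W u w $$ (a, b)"
    proof (cases "u = w")
      case True
      then show ?thesis using finE ab
        by (simp add: laplacian_block_def of_bool_def if_distrib[of "\<lambda>t. t * _"] sum.inter_filter cong: if_cong)
    next
      case False
      have "(\<Sum>e\<in>E. - of_bool ({u, w} = e) * W e $$ (a, b))
          = (\<Sum>e\<in>E. if {u, w} = e then - W e $$ (a, b) else 0)"
        by (rule sum.cong) auto
      also have "\<dots> = laplacian_block s E W u w $$ (a, b)"
        using False finE ab assms(4)[of "{u, w}"] by (auto simp: laplacian_block_def sum.delta)
      finally show ?thesis using False by simp
    qed
    finally show "(\<Sum>x\<in>set us. incidence par u x * incidence par w x * W {x, par x} $$ (a, b))
      = laplacian_block s E W u w $$ (a, b)" .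
  qed
  also have "\<dots> = delete_vertex_block s vs v (laplacian s vs E W)"
    using assms(2,3,5) by (simp add: laplacian_eq_block_mat delete_vertex_block_mat us_def)
  finally have fact: "delete_vertex_block s vs v (laplacian s vs E W) = Q * D * transpose_mat Q" ..
  let ?N = "length us * s"
  have QD: "Q \<in> carrier_mat ?N ?N" "D \<in> carrier_mat ?N ?N" by (simp_all add: Q_def D_def)
  have "det Q = 1" unfolding Q_def by (rule det_incidence[OF us(1), of depth]) (use depth us(2) in blast)
  moreover have "det D = (\<Prod>x\<in>V - {v}. det (W {x, par x}))"
    unfolding D_def using det_block_diagonal[OF us(1), of "\<lambda>x. W {x, par x}" s] W us(2) by simp
  moreover have "\<dots> = (\<Prod>e\<in>E. det (W e))"
    using prod.reindex_bij_betw[OF bij, of "\<lambda>e. det (W e)"] .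
  ultimately show ?thesis
    unfolding fact using QD by (simp add: det_mult[of _ ?N] det_transpose)
qed

end
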